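(* Let $k$ be an odd positive integer, let $Q_{\mathrm{rig}}(x)$ be the inventory polynomial of rigid bicolour pattern classes over $S=\mathbb{Z}/2k\mathbb{Z}$, and let $s(2k)$ be the number of strong dichotomy classes over $S$ (i.e., classes of rigid self-complementary bicolour patterns). Then \[ Q_{\mathrm{rig}}(-1) = -s(2k). \]
   Context: Let $S=\mathbb{Z}/2k\mathbb{Z}$ and let $G=\mathrm{Aff}(\mathbb{Z}/2k\mathbb{Z})=(\mathbb{Z}/2k\mathbb{Z})\rtimes(\mathbb{Z}/2k\mathbb{Z})^{\times}$ be the affine group, whose elements $e^{u}.v$ (with $u\in\mathbb{Z}/2k\mathbb{Z}$, $v\in(\mathbb{Z}/2k\mathbb{Z})^{\times}$) act on $S$ by $x\mapsto vx+u$. $G$ acts on subsets of $S$ by $gA=\{g(a):a\in A\}$; bicolour patterns are identified with subsets $A\subseteq S$, and the classes of patterns are the $G$-orbits. Write $G_A=\{g\in G: gA=A\}$ for the (setwise) stabilizer of $A$. A subset $A\subseteq S$ is rigid if $G_A=1$ (the trivial subgroup). Let $\mathcal{R}=\{A\subseteq S: G_A=1\}$. The inventory polynomial of rigid pattern classes is \[ Q_{\mathrm{rig}}(x)=\sum_{A\in\mathcal{R}/G}x^{|A|}, \] where the sum runs over one representative $A$ of each $G$-orbit in $\mathcal{R}$. A subset $D\subseteq S$ is self-complementary if there is $g\in G$ with $gD=S\setminus D$ (so necessarily $|D|=k$). A strong dichotomy is a subset that is both rigid and self-complementary; $s(2k)$ is the number of $G$-orbits of strong dichotomies. *)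

theory Defs
  imports
    "HOL-Number_Theory.Residues"
    "HOL-Algebra.Group_Action"
    "HOL-Computational_Algebra.Polynomial"
begin

text \<open>
  The pair \<open>(u, v)\<close> stands for \<open>e\<^sup>u.v\<close>, i.e. for the map \<open>x \<mapsto> v x + u\<close>; the multiplication is
  that of the semidirect product of the additive group by the units, matching composition of maps.
\<close>

definition affine_group :: "('a, 'b) ring_scheme \<Rightarrow> ('a \<times> 'a) monoid" where
  "affine_group R =
    \<lparr>carrier = carrier R \<times> Units R,
     monoid.mult = (\<lambda>(u, v) (u', v'). (u \<oplus>\<^bsub>R\<^esub> v \<otimes>\<^bsub>R\<^esub> u', v \<otimes>\<^bsub>R\<^esub> v')),
     one = (\<zero>\<^bsub>R\<^esub>, \<one>\<^bsub>R\<^esub>)\<rparr>"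

definition affine_map :: "('a, 'b) ring_scheme \<Rightarrow> 'a \<times> 'a \<Rightarrow> 'a \<Rightarrow> 'a" where
  "affine_map R = (\<lambda>(u, v) x. v \<otimes>\<^bsub>R\<^esub> x \<oplus>\<^bsub>R\<^esub> u)"

text \<open>Elements of \<^const>\<open>BijGroup\<close> are extensional functions, hence the restriction to subsets
  of the carrier.\<close>

definition pattern_action :: "('a, 'b) ring_scheme \<Rightarrow> 'a \<times> 'a \<Rightarrow> 'a set \<Rightarrow> 'a set" where
  "pattern_action R g = (\<lambda>A \<in> Pow (carrier R). affine_map R g ` A)"

definition rigid :: "('a, 'b) ring_scheme \<Rightarrow> 'a set \<Rightarrow> bool" where
  "rigid R A \<longleftrightarrow> A \<subseteq> carrier R \<and>
     stabilizer (affine_group R) (pattern_action R) A = {\<one>\<^bsub>affine_group R\<^esub>}"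

definition self_complementary :: "('a, 'b) ring_scheme \<Rightarrow> 'a set \<Rightarrow> bool" where
  "self_complementary R D \<longleftrightarrow> D \<subseteq> carrier R \<and>
     (\<exists>g \<in> carrier (affine_group R). pattern_action R g D = carrier R - D)"

definition strong_dichotomy :: "('a, 'b) ring_scheme \<Rightarrow> 'a set \<Rightarrow> bool" where
  "strong_dichotomy R D \<longleftrightarrow> rigid R D \<and> self_complementary R D"

definition rigid_classes :: "('a, 'b) ring_scheme \<Rightarrow> 'a set set set" where
  "rigid_classes R = orbits (affine_group R) {A. rigid R A} (pattern_action R)"

definition strong_dichotomy_classes :: "('a, 'b) ring_scheme \<Rightarrow> 'a set set set" where
  "strong_dichotomy_classes R =
     orbits (affine_group R) {D. strong_dichotomy R D} (pattern_action R)"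

text \<open>In both of the following, \<open>n\<close> is the order of the residue ring. The representative chosen
  in \<open>Q_rig\<close> does not matter, see \<open>card_eq_if_same_orbit\<close> below.\<close>

definition Q_rig :: "nat \<Rightarrow> int poly" where
  "Q_rig n = (\<Sum>C \<in> rigid_classes (residue_ring (int n)). Polynomial.monom 1 (card (SOME A. A \<in> C)))"

definition num_strong_dichotomy_classes :: "nat \<Rightarrow> nat" where
  "num_strong_dichotomy_classes n = card (strong_dichotomy_classes (residue_ring (int n)))"

context cring
begin

lemma affine_map_closed:
  "g \<in> carrier (affine_group R) \<Longrightarrow> x \<in> carrier R \<Longrightarrow> affine_map R g x \<in> carrier R"
  by (auto simp: affine_group_def affine_map_def)

lemma affine_map_mult:
  assumes "g \<in> carrier (affine_group R)" "h \<in> carrier (affine_group R)" "x \<in> carrier R"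
  shows "affine_map R (g \<otimes>\<^bsub>affine_group R\<^esub> h) x = affine_map R g (affine_map R h x)"
  using assms by (auto simp: affine_group_def affine_map_def Units_closed r_distr m_assoc a_ac)

lemma group_affine_group: "group (affine_group R)"
proof (rule groupI)
  fix x assume "x \<in> carrier (affine_group R)"
  then obtain u v where x: "x = (u, v)" "u \<in> carrier R" "v \<in> Units R"
    by (auto simp: affine_group_def)
  have "(\<ominus> (inv v \<otimes> u), inv v) \<in> carrier (affine_group R)"
    using x by (auto simp: affine_group_def)
  moreover have "(\<ominus> (inv v \<otimes> u), inv v) \<otimes>\<^bsub>affine_group R\<^esub> x = \<one>\<^bsub>affine_group R\<^esub>"
    using x by (auto simp: affine_group_def l_neg)
  ultimately show "\<exists>y\<in>carrier (affine_group R). y \<otimes>\<^bsub>affine_group R\<^esub> x = \<one>\<^bsub>affine_group R\<^esub>"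
    by blast
qed (auto simp: affine_group_def Units_closed r_distr m_assoc a_assoc)

lemma affine_map_one: "x \<in> carrier R \<Longrightarrow> affine_map R \<one>\<^bsub>affine_group R\<^esub> x = x"
  by (auto simp: affine_group_def affine_map_def)

lemma bij_betw_affine_map:
  assumes g: "g \<in> carrier (affine_group R)"
  shows "bij_betw (affine_map R g) (carrier R) (carrier R)"
proof -
  interpret G: group "affine_group R" by (rule group_affine_group)
  let ?h = "inv\<^bsub>affine_group R\<^esub> g"
  have h: "?h \<in> carrier (affine_group R)" using g by simp
  show ?thesis
  proof (rule bij_betw_byWitness[where f' = "affine_map R ?h"])
    show "\<forall>a\<in>carrier R. affine_map R ?h (affine_map R g a) = a"
      using affine_map_mult[OF h g] affine_map_one G.l_inv[OF g] by simp
    show "\<forall>a\<in>carrier R. affine_map R g (affine_map R ?h a) = a"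
      using affine_map_mult[OF g h] affine_map_one G.r_inv[OF g] by simp
  qed (use affine_map_closed[OF g] affine_map_closed[OF h] in auto)
qed

lemma group_action_pattern_action:
  "group_action (affine_group R) (Pow (carrier R)) (pattern_action R)"
proof -
  have bij: "pattern_action R g \<in> Bij (Pow (carrier R))" if "g \<in> carrier (affine_group R)" for g
    using bij_betw_Pow[OF bij_betw_affine_map[OF that]]
    by (auto simp: Bij_def pattern_action_def)
  show ?thesis
    unfolding group_action_def group_hom_def group_hom_axioms_def
  proof (intro conjI group_affine_group group_BijGroup homI)
    fix g h assume gh: "g \<in> carrier (affine_group R)" "h \<in> carrier (affine_group R)"
    have "pattern_action R (g \<otimes>\<^bsub>affine_group R\<^esub> h)
        = compose (Pow (carrier R)) (pattern_action R g) (pattern_action R h)"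
    proof
      fix A
      show "pattern_action R (g \<otimes>\<^bsub>affine_group R\<^esub> h) A
          = compose (Pow (carrier R)) (pattern_action R g) (pattern_action R h) A"
      proof (cases "A \<subseteq> carrier R")
        case True
        then have "affine_map R h ` A \<subseteq> carrier R"
          using affine_map_closed[OF gh(2)] by auto
        moreover have "affine_map R (g \<otimes>\<^bsub>affine_group R\<^esub> h) ` A = affine_map R g ` affine_map R h ` A"
          unfolding image_image using True affine_map_mult[OF gh] by (intro image_cong) auto
        ultimately show ?thesis
          using True by (simp add: pattern_action_def compose_def)
      qed (simp add: pattern_action_def compose_def)
    qed
    then show "pattern_action R (g \<otimes>\<^bsub>affine_group R\<^esub> h)
        = pattern_action R g \<otimes>\<^bsub>BijGroup (Pow (carrier R))\<^esub> pattern_action R h"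
      using bij gh by (simp add: BijGroup_def)
  qed (use bij in \<open>simp add: BijGroup_def\<close>)
qed

lemma card_eq_if_same_orbit:
  assumes "A \<subseteq> carrier R" "B \<in> orbit (affine_group R) (pattern_action R) A"
  shows "card B = card A"
proof -
  obtain g where g: "g \<in> carrier (affine_group R)" "B = affine_map R g ` A"
    using assms by (auto simp: orbit_def pattern_action_def)
  then show ?thesis
    using bij_betw_affine_map[OF g(1)] assms(1)
    by (metis bij_betw_imp_inj_on card_image inj_on_subset)
qed

end

end

theory Submission
  imports Defs
begin

text \<open>
  Rigid patterns have free orbits, so \<open>|G| Q\<^sub>r\<^sub>i\<^sub>g(-1)\<close> is the sum of \<open>(-1)\<^bsup>|A|\<^esup>\<close> over all rigid
  \<^emph>\<open>sets\<close> \<open>A\<close>, and \<open>|G| s(2k)\<close> is the number of strong dichotomies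
  (\<open>sum_over_free_orbits\<close>). A self-complementary set has the odd size \<open>k\<close>, so each strong
  dichotomy contributes \<open>-1\<close> to that sum. It remains to see that the rigid sets which are not
  self-complementary contribute \<open>0\<close> in total.

  Let \<open>O\<close> be the set of odd residues and let \<open>\<tau> A\<close> be the symmetric difference of \<open>A\<close> and \<open>O\<close>.
  Since \<open>|O| = k\<close> is odd, the involution \<open>\<tau>\<close> reverses the sign \<open>(-1)\<^bsup>|A|\<^esup>\<close>. As units modulo \<open>2k\<close>
  are odd, each affine map \<open>g = e\<^sup>u.v\<close> either preserves \<open>O\<close> (\<open>u\<close> even) or exchanges \<open>O\<close> with its
  complement (\<open>u\<close> odd). Hence \<open>g (\<tau> A)\<close> is \<open>\<tau> (g A)\<close> in the first case and its complement in the
  second. So a \<open>g\<close> with \<open>g (\<tau> A) = \<tau> A\<close> satisfies \<open>g A = A\<close> or \<open>g A = S - A\<close>, and so does a \<open>g\<close>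
  that maps \<open>\<tau> A\<close> to its complement. If \<open>A\<close> is rigid and not self-complementary, only
  \<open>g A = A\<close> is possible, that is \<open>g = 1\<close>; it preserves \<open>O\<close>, so it fixes \<open>\<tau> A\<close> and does not
  complement it. Therefore \<open>\<tau> A\<close> is again rigid and not self-complementary
  (\<open>toggle_odds_preserves_rigid_not_self_complementary\<close>), and \<open>\<tau>\<close> cancels these sets in pairs.

  The map \<open>\<tau>\<close> does not descend to \<open>G\<close>-orbits, since \<open>\<tau> (g A)\<close> may lie in the orbit of the
  complement of \<open>\<tau> A\<close>. This is why the cancellation takes place on sets and not on classes.
\<close>

section \<open>Free orbits\<close>

text \<open>The stabilizer of \<open>g x\<close> is conjugate to that of \<open>x\<close>.\<close>

lemma (in group_action) stabilizer_trivial_image: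
  assumes x: "x \<in> E" and triv: "stabilizer G \<phi> x = {\<one>}" and g: "g \<in> carrier G"
  shows "stabilizer G \<phi> (\<phi> g x) = {\<one>}"
proof -
  interpret G: group G using group_hom group_hom.axioms(1) by auto
  have gx: "\<phi> g x \<in> E" using element_image[OF g x] by simp
  have "h = \<one>" if h: "h \<in> stabilizer G \<phi> (\<phi> g x)" for h
  proof -
    have hG: "h \<in> carrier G" and hgx: "\<phi> h (\<phi> g x) = \<phi> g x"
      using h by (auto simp: stabilizer_def)
    have "\<phi> (inv g \<otimes> (h \<otimes> g)) x = \<phi> (inv g) (\<phi> g x)"
      using x g hG hgx by (simp add: composition_rule)
    then have "\<phi> (inv g \<otimes> (h \<otimes> g)) x = x"
      using orbit_sym_aux[OF g x] by simp
    then have "inv g \<otimes> (h \<otimes> g) \<in> stabilizer G \<phi> x"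
      using g hG by (simp add: stabilizer_def)
    then have "inv g \<otimes> (h \<otimes> g) = \<one>" using triv by simp
    then have "h \<otimes> g = g"
      using g hG G.inv_solve_left'[of "\<one>" g "h \<otimes> g"] by simp
    then show ?thesis using g hG by (simp add: G.r_cancel_one)
  qed
  then show ?thesis using stabilizer_one_closed[OF gx] by blast
qed

text \<open>Each free orbit has \<open>|G|\<close> elements by the orbit-stabilizer theorem, so counting elements
  instead of orbits multiplies each term by the same factor. This turns identities between orbit
  counts into identities between sums over sets.\<close>

lemma (in group_action) sum_over_free_orbits:
  fixes f :: "_ \<Rightarrow> 's :: semiring_1"
  assumes fin: "finite (carrier G)" "finite X" and sub: "X \<subseteq> E"
    and inv: "\<And>g x. g \<in> carrier G \<Longrightarrow> x \<in> X \<Longrightarrow> \<phi> g x \<in> X"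
    and free: "\<And>x. x \<in> X \<Longrightarrow> stabilizer G \<phi> x = {\<one>}"
    and const: "\<And>x y. x \<in> X \<Longrightarrow> y \<in> orbit G \<phi> x \<Longrightarrow> f y = f x"
  shows "of_nat (card (carrier G)) * (\<Sum>C \<in> orbits G X \<phi>. f (SOME x. x \<in> C)) = (\<Sum>x \<in> X. f x)"
proof -
  have orb: "C \<noteq> {}" "C \<subseteq> X" "card C = card (carrier G)" "\<And>x y. x \<in> C \<Longrightarrow> y \<in> C \<Longrightarrow> f x = f y"
    if C: "C \<in> orbits G X \<phi>" for C
  proof -
    obtain x where x: "x \<in> X" "C = orbit G \<phi> x" using C by (auto simp: orbits_def)
    show "C \<noteq> {}" using x orbit_refl sub by blast
    show "C \<subseteq> X" using x inv by (auto simp: orbit_def)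
    show "card C = card (carrier G)"
      using orbit_stabilizer_theorem[of x] x sub free by (force simp: Coset.order_def)
    show "f y = f z" if "y \<in> C" "z \<in> C" for y z
      using const x that by metis
  qed
  have sub_orbits: "orbits G X \<phi> \<subseteq> orbits G E \<phi>"
    using sub by (auto simp: orbits_def)
  have Union: "\<Union> (orbits G X \<phi>) = X"
  proof
    show "X \<subseteq> \<Union> (orbits G X \<phi>)"
      using orbit_refl sub by (auto simp: orbits_def)
  qed (use orb in blast)
  have "(\<Sum>x \<in> X. f x) = (\<Sum>x \<in> \<Union> (orbits G X \<phi>). f x)"
    by (simp only: Union)
  also have "\<dots> = (\<Sum>C \<in> orbits G X \<phi>. \<Sum>x \<in> C. f x)"
  proof -
    have "\<forall>C \<in> orbits G X \<phi>. finite C"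
      using finite_subset[OF orb(2) fin(2)] by blast
    moreover have "\<forall>C \<in> orbits G X \<phi>. \<forall>D \<in> orbits G X \<phi>. C \<noteq> D \<longrightarrow> C \<inter> D = {}"
      using disjoint_union sub_orbits by blast
    ultimately show ?thesis by (simp add: sum.Union_disjoint)
  qed
  also have "\<dots> = (\<Sum>C \<in> orbits G X \<phi>. of_nat (card (carrier G)) * f (SOME x. x \<in> C))"
  proof (rule sum.cong)
    fix C assume C: "C \<in> orbits G X \<phi>"
    then have "(SOME x. x \<in> C) \<in> C" using orb(1) by (simp add: some_in_eq)
    then have "(\<Sum>x \<in> C. f x) = (\<Sum>x \<in> C. f (SOME x. x \<in> C))"
      by (intro sum.cong refl orb(4)[OF C])
    then show "(\<Sum>x \<in> C. f x) = of_nat (card (carrier G)) * f (SOME x. x \<in> C)"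
      using orb(3)[OF C] by simp
  qed simp
  finally show ?thesis by (simp add: sum_distrib_left)
qed

section \<open>The action on rigid and self-complementary patterns\<close>

context cring
begin

interpretation P: group_action "affine_group R" "Pow (carrier R)" "pattern_action R"
  by (rule group_action_pattern_action)

lemma pattern_action_subset:
  assumes "g \<in> carrier (affine_group R)" "A \<subseteq> carrier R"
  shows "pattern_action R g A \<subseteq> carrier R"
  using P.element_image[OF assms(1)] assms(2) by auto

lemma pattern_action_diff:
  assumes "g \<in> carrier (affine_group R)" "A \<subseteq> carrier R" "B \<subseteq> carrier R"
  shows "pattern_action R g (A - B) = pattern_action R g A - pattern_action R g B"
proof -
  have "A - B \<subseteq> carrier R" using assms(2) by blast
  then show ?thesis
    using assms inj_on_image_set_diff[OF bij_betw_imp_inj_on[OF bij_betw_affine_map[OF assms(1)]]]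
    by (auto simp: pattern_action_def)
qed

lemma pattern_action_Un:
  assumes "A \<subseteq> carrier R" "B \<subseteq> carrier R"
  shows "pattern_action R g (A \<union> B) = pattern_action R g A \<union> pattern_action R g B"
  using assms by (simp add: pattern_action_def image_Un)

lemma pattern_action_carrier:
  assumes "g \<in> carrier (affine_group R)"
  shows "pattern_action R g (carrier R) = carrier R"
  using bij_betw_imp_surj_on[OF bij_betw_affine_map[OF assms]] by (simp add: pattern_action_def)

lemma card_pattern_action:
  assumes "g \<in> carrier (affine_group R)" "A \<subseteq> carrier R"
  shows "card (pattern_action R g A) = card A"
  using assms by (intro card_eq_if_same_orbit) (unfold orbit_def, blast+)

lemma rigid_pattern_action:
  assumes "rigid R A" "g \<in> carrier (affine_group R)"
  shows "rigid R (pattern_action R g A)"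
  using assms P.stabilizer_trivial_image pattern_action_subset by (simp add: rigid_def)

text \<open>If \<open>h\<close> complements \<open>D\<close>, then \<open>g h g\<^sup>-\<^sup>1\<close> complements \<open>g D\<close>.\<close>

lemma self_complementary_pattern_action:
  assumes "self_complementary R D" and g: "g \<in> carrier (affine_group R)"
  shows "self_complementary R (pattern_action R g D)"
proof -
  interpret G: group "affine_group R" by (rule group_affine_group)
  obtain h where D: "D \<subseteq> carrier R" and h: "h \<in> carrier (affine_group R)"
    and hD: "pattern_action R h D = carrier R - D"
    using assms(1) by (auto simp: self_complementary_def)
  let ?g' = "inv\<^bsub>affine_group R\<^esub> g"
  have "pattern_action R (g \<otimes>\<^bsub>affine_group R\<^esub> h \<otimes>\<^bsub>affine_group R\<^esub> ?g') (pattern_action R g D)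
      = pattern_action R (g \<otimes>\<^bsub>affine_group R\<^esub> h) (pattern_action R ?g' (pattern_action R g D))"
    using g h pattern_action_subset[OF g D] by (intro P.composition_rule) auto
  also have "\<dots> = pattern_action R (g \<otimes>\<^bsub>affine_group R\<^esub> h) D"
    using P.orbit_sym_aux[OF g, of D] D by simp
  also have "\<dots> = pattern_action R g (carrier R - D)"
    using P.composition_rule[of D g h] g h D hD by simp
  also have "\<dots> = carrier R - pattern_action R g D"
    using g D by (simp add: pattern_action_diff pattern_action_carrier)
  finally show ?thesis
    using g h pattern_action_subset[OF g D] unfolding self_complementary_def by blast
qed

lemma card_self_complementary:
  assumes fin: "finite (carrier R)" and D: "self_complementary R D"
  shows "2 * card D = card (carrier R)"
proof -
  obtain g where sub: "D \<subseteq> carrier R" and g: "g \<in> carrier (affine_group R)"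
    and gD: "pattern_action R g D = carrier R - D"
    using D by (auto simp: self_complementary_def)
  have "card (carrier R - D) = card D"
    using card_pattern_action[OF g sub] gD by simp
  moreover have "card D \<le> card (carrier R)" using fin sub by (rule card_mono)
  ultimately show ?thesis using card_Diff_subset[OF finite_subset[OF sub fin] sub] by linarith
qed

lemma order_times_sum_over_rigid_classes:
  fixes x :: int
  assumes fin: "finite (carrier R)"
  shows "int (card (carrier (affine_group R))) *
      (\<Sum>C \<in> rigid_classes R. x ^ card (SOME A. A \<in> C)) = (\<Sum>A | rigid R A. x ^ card A)"
  unfolding rigid_classes_def
proof (rule P.sum_over_free_orbits)
  show "finite (carrier (affine_group R))"
    using fin by (auto simp: affine_group_def Units_def)
  show "finite {A. rigid R A}"
    by (rule finite_subset[of _ "Pow (carrier R)"]) (use fin in \<open>auto simp: rigid_def\<close>)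
next
  fix A B assume "A \<in> {A. rigid R A}" "B \<in> orbit (affine_group R) (pattern_action R) A"
  then show "x ^ card B = x ^ card A"
    using card_eq_if_same_orbit[of A B] by (simp add: rigid_def)
qed (use rigid_pattern_action in \<open>auto simp: rigid_def\<close>)

lemma order_times_strong_dichotomy_classes:
  assumes fin: "finite (carrier R)"
  shows "int (card (carrier (affine_group R))) * int (card (strong_dichotomy_classes R)) =
      int (card {D. strong_dichotomy R D})"
proof -
  have "int (card (carrier (affine_group R))) * (\<Sum>C \<in> strong_dichotomy_classes R. 1) =
      (\<Sum>D | strong_dichotomy R D. 1)"
    unfolding strong_dichotomy_classes_def
  proof (rule P.sum_over_free_orbits)
    show "finite (carrier (affine_group R))"
      using fin by (auto simp: affine_group_def Units_def)
    show "finite {D. strong_dichotomy R D}"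
      by (rule finite_subset[of _ "Pow (carrier R)"])
        (use fin in \<open>auto simp: strong_dichotomy_def rigid_def\<close>)
  qed (auto simp: strong_dichotomy_def rigid_pattern_action self_complementary_pattern_action,
      auto simp: rigid_def)
  then show ?thesis by simp
qed

end

section \<open>Toggling the odd residues\<close>

definition odds :: "('a :: semiring_parity, 'b) ring_scheme \<Rightarrow> 'a set" where
  "odds R = {x \<in> carrier R. odd x}"

definition toggle_odds :: "('a :: semiring_parity, 'b) ring_scheme \<Rightarrow> 'a set \<Rightarrow> 'a set" where
  "toggle_odds R A = sym_diff A (odds R)"

lemma toggle_odds_subset: "A \<subseteq> carrier R \<Longrightarrow> toggle_odds R A \<subseteq> carrier R"
  by (auto simp: toggle_odds_def odds_def)

lemma toggle_odds_toggle_odds: "toggle_odds R (toggle_odds R A) = A"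
  by (auto simp: toggle_odds_def)

lemma toggle_odds_compl:
  "A \<subseteq> carrier R \<Longrightarrow> toggle_odds R (carrier R - A) = carrier R - toggle_odds R A"
  by (auto simp: toggle_odds_def odds_def)

lemma card_sym_diff:
  assumes "finite A" "finite B"
  shows "card (sym_diff A B) + 2 * card (A \<inter> B) = card A + card B"
proof -
  have "card (sym_diff A B) = card (A - B) + card (B - A)"
    using assms by (intro card_Un_disjoint) auto
  moreover have "card A = card (A - B) + card (A \<inter> B)"
    using assms card_Un_disjoint[of "A - B" "A \<inter> B"]
    by (metis Diff_disjoint Int_Diff Int_commute Un_Diff_Int finite_Diff finite_Int inf_bot_right)
  moreover have "card B = card (B - A) + card (A \<inter> B)"
    using assms card_Un_disjoint[of "B - A" "A \<inter> B"]
    by (metis Diff_disjoint Int_Diff Int_commute Un_Diff_Int finite_Diff finite_Int inf_bot_right)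
  ultimately show ?thesis by linarith
qed

context residues
begin

lemma pattern_action_odds:
  assumes "even m" and g: "(u, v) \<in> carrier (affine_group R)"
  shows "pattern_action R (u, v) (odds R) = (if even u then odds R else carrier R - odds R)"
proof -
  have "coprime v m" using g by (simp add: affine_group_def res_units_eq)
  then have v: "odd v" using \<open>even m\<close> by (meson coprime_common_divisor odd_one)
  let ?f = "affine_map R (u, v)"
  have par: "odd (?f x) \<longleftrightarrow> odd (x + u)" for x
    using v \<open>even m\<close> by (simp add: affine_map_def res_add_eq res_mult_eq dvd_mod_iff)
  have bij: "bij_betw ?f (carrier R) (carrier R)" using g by (rule bij_betw_affine_map)
  have "?f ` odds R = {y \<in> carrier R. odd (y + u)}"
  proof (intro subset_antisym subsetI)
    fix y assume "y \<in> {y \<in> carrier R. odd (y + u)}"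
    moreover from this obtain x where "x \<in> carrier R" "y = ?f x"
      using bij by (auto simp: bij_betw_def)
    ultimately show "y \<in> ?f ` odds R" using par by (auto simp: odds_def)
  qed (use par bij_betwE[OF bij] in \<open>auto simp: odds_def\<close>)
  then show ?thesis by (auto simp: pattern_action_def odds_def)
qed

text \<open>Affine maps commute with symmetric differences, so \<open>g\<close> commutes with toggling, except that
  toggling with the even residues instead of the odd ones yields the complement.\<close>

lemma pattern_action_toggle_odds:
  assumes "even m" and g: "g \<in> carrier (affine_group R)" and A: "A \<subseteq> carrier R"
  shows "pattern_action R g (toggle_odds R A) =
    (if even (fst g) then toggle_odds R (pattern_action R g A)
     else carrier R - toggle_odds R (pattern_action R g A))"
proof -
  obtain u v where uv: "g = (u, v)" by (cases g)
  have O: "odds R \<subseteq> carrier R" by (auto simp: odds_def)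
  have "pattern_action R g (toggle_odds R A)
      = sym_diff (pattern_action R g A) (pattern_action R g (odds R))"
    unfolding toggle_odds_def using g A O
    by (subst pattern_action_Un) (auto simp: pattern_action_diff)
  then show ?thesis
    using pattern_action_odds[OF \<open>even m\<close>, of u v] g uv pattern_action_subset[OF g A] O
    by (auto simp: toggle_odds_def)
qed

text \<open>By the dichotomy for \<open>g\<close>, toggling can turn a fixed set into a complemented one and conversely,
  but whether \<open>g\<close> does one of the two is the same for \<open>A\<close> and for the toggled set.\<close>

lemma toggle_odds_preserves_rigid_not_self_complementary:
  assumes "even m" and rigid: "rigid R A" and nsc: "\<not> self_complementary R A"
  shows "rigid R (toggle_odds R A) \<and> \<not> self_complementary R (toggle_odds R A)"
proof -
  interpret P: group_action "affine_group R" "Pow (carrier R)" "pattern_action R"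
    by (rule group_action_pattern_action)
  have A: "A \<subseteq> carrier R" using rigid by (simp add: rigid_def)
  let ?T = "toggle_odds R A"
  have T: "?T \<subseteq> carrier R" using A by (rule toggle_odds_subset)
  \<comment> \<open>As toggling is an involution, \<open>A\<close> is itself the toggled \<open>?T\<close>, which expresses \<open>g A\<close> by \<open>g ?T\<close>.\<close>
  have act: "pattern_action R g A =
      toggle_odds R (if even (fst g) then pattern_action R g ?T
        else carrier R - pattern_action R g ?T)"
    if "g \<in> carrier (affine_group R)" for g
    using pattern_action_toggle_odds[OF \<open>even m\<close> that T]
      toggle_odds_compl[OF pattern_action_subset[OF that T]]
    by (simp add: toggle_odds_toggle_odds)
  have one: "g = \<one>\<^bsub>affine_group R\<^esub>"
    if g: "g \<in> carrier (affine_group R)"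
      and "pattern_action R g ?T = ?T \<or> pattern_action R g ?T = carrier R - ?T" for g
  proof -
    have "pattern_action R g A = A \<or> pattern_action R g A = carrier R - A"
      using act[OF g] that(2) toggle_odds_compl[OF T] T
      by (auto simp: toggle_odds_toggle_odds double_diff split: if_splits)
    then have "pattern_action R g A = A"
      using nsc g A by (auto simp: self_complementary_def)
    then show ?thesis using rigid g by (auto simp: rigid_def stabilizer_def)
  qed
  have "\<one>\<^bsub>affine_group R\<^esub> \<in> stabilizer (affine_group R) (pattern_action R) ?T"
    using T by (intro P.stabilizer_one_closed) auto
  moreover from this have "pattern_action R \<one>\<^bsub>affine_group R\<^esub> ?T \<noteq> carrier R - ?T"
    using T zero_closed by (auto simp: stabilizer_def)
  ultimately show ?thesis
    using one T by (auto simp: rigid_def self_complementary_def stabilizer_def)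
qed

text \<open>Toggling is a sign-reversing involution on the sets summed over, because it changes the size
  of a set by an odd number.\<close>

lemma sum_rigid_not_self_complementary:
  assumes "even m" and odd: "odd (card (odds R))"
  shows "(\<Sum>A | rigid R A \<and> \<not> self_complementary R A. (-1 :: int) ^ card A) = 0"
proof -
  let ?X = "{A. rigid R A \<and> \<not> self_complementary R A}"
  have "(\<Sum>A \<in> ?X. (-1 :: int) ^ card A) = (\<Sum>A \<in> ?X. - ((-1) ^ card A))"
  proof (rule sum.reindex_bij_witness[where i = "toggle_odds R" and j = "toggle_odds R"])
    fix A assume "A \<in> ?X"
    then have "A \<subseteq> carrier R" by (simp add: rigid_def)
    then have "finite A" by (rule finite_subset) simp
    moreover have "finite (odds R)" by (simp add: odds_def)
    ultimately have "even (card (toggle_odds R A)) \<longleftrightarrow> odd (card A)"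
      using odd card_sym_diff[of A "odds R"] unfolding toggle_odds_def by presburger
    then show "- ((-1) ^ card (toggle_odds R A)) = (-1 :: int) ^ card A"
      by (auto simp: minus_one_power_iff)
  qed (use toggle_odds_preserves_rigid_not_self_complementary[OF \<open>even m\<close>]
      in \<open>auto simp: toggle_odds_toggle_odds\<close>)
  then show ?thesis by (simp add: sum_negf)
qed

end

section \<open>The value at -1\<close>

theorem theorem6p1:
  fixes k :: nat
  assumes "odd k" and "k > 0"
  shows "poly (Q_rig (2 * k)) (-1) = - int (num_strong_dichotomy_classes (2 * k))"
proof -
  define R where "R = residue_ring (2 * int k)"
  interpret residues "2 * int k" R
    by unfold_locales (use \<open>k > 0\<close> in \<open>auto simp: R_def\<close>)
  have carr: "carrier R = {0..2 * int k - 1}" by (rule res_carrier_eq)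
  have "odds R = (\<lambda>i. 2 * int i + 1) ` {..<k}"
  proof (intro subset_antisym subsetI)
    fix x assume "x \<in> odds R"
    then obtain j where "x = 2 * j + 1" "0 \<le> x" "x < 2 * int k"
      by (auto simp: odds_def carr elim: oddE)
    then show "x \<in> (\<lambda>i. 2 * int i + 1) ` {..<k}"
      by (intro image_eqI[of _ _ "nat j"]) auto
  qed (auto simp: odds_def carr)
  then have card_odds: "card (odds R) = k"
    by (simp add: card_image inj_on_def)
  have fin: "finite {A. rigid R A}"
    by (rule finite_subset[of _ "Pow (carrier R)"]) (auto simp: rigid_def)
  have card_strong: "card D = k" if "strong_dichotomy R D" for D
    using that card_self_complementary[OF finite, of D] by (auto simp: strong_dichotomy_def carr)

  let ?N = "int (card (carrier (affine_group R)))"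
  have "?N * poly (Q_rig (2 * k)) (-1) = (\<Sum>A | rigid R A. (-1) ^ card A)"
    using order_times_sum_over_rigid_classes[OF finite, of "-1"]
    by (simp add: Q_rig_def poly_sum poly_monom flip: R_def)
  also have "\<dots> = (\<Sum>A | strong_dichotomy R A. (-1) ^ card A)
      + (\<Sum>A | rigid R A \<and> \<not> self_complementary R A. (-1) ^ card A)"
  proof -
    have "{A. rigid R A} = {A. strong_dichotomy R A} \<union> {A. rigid R A \<and> \<not> self_complementary R A}"
      by (auto simp: strong_dichotomy_def)
    moreover from this have "finite {A. strong_dichotomy R A}"
      "finite {A. rigid R A \<and> \<not> self_complementary R A}"
      using fin by simp_all
    moreover have "{A. strong_dichotomy R A} \<inter> {A. rigid R A \<and> \<not> self_complementary R A} = {}"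
      by (auto simp: strong_dichotomy_def)
    ultimately show ?thesis by (simp only: sum.union_disjoint)
  qed
  also have "(\<Sum>A | rigid R A \<and> \<not> self_complementary R A. (-1 :: int) ^ card A) = 0"
    using \<open>odd k\<close> card_odds by (intro sum_rigid_not_self_complementary) auto
  also have "(\<Sum>A | strong_dichotomy R A. (-1 :: int) ^ card A) = - int (card {D. strong_dichotomy R D})"
    using card_strong \<open>odd k\<close> by simp
  also have "\<dots> + 0 = ?N * - int (num_strong_dichotomy_classes (2 * k))"
    using order_times_strong_dichotomy_classes[OF finite]
    by (simp add: num_strong_dichotomy_classes_def flip: R_def)
  finally have "?N * poly (Q_rig (2 * k)) (-1) = ?N * - int (num_strong_dichotomy_classes (2 * k))" .
  moreover have "?N \<noteq> 0"
  proof -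
    interpret G: group "affine_group R" by (rule group_affine_group)
    have "finite (carrier (affine_group R))" by (simp add: affine_group_def)
    then show ?thesis using G.one_closed by (auto simp: card_eq_0_iff)
  qed
  ultimately show ?thesis using mult_left_cancel[of ?N] by blast
qed

end
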